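(* Let $\alpha$ be a continuous rotationally symmetric norm on $L^\infty(\mathbb T)$. The following are equivalent: (1) (the General Continuity Theorem holds in $\mathcal L^\alpha(\mathbb T)$) for every $g\in\mathcal L^\alpha(\mathbb T)$, $\lim_{m(E)\to0^+}\alpha(g\chi_E)=0$; (2) (the Dominated Convergence Theorem holds in $\mathcal L^\alpha(\mathbb T)$) for every $g\in\mathcal L^\alpha(\mathbb T)$, if $K_g=\mathrm{co}(\{|g\circ\varphi|\,u:\|u\|_\infty\le1,\ \varphi\in G_\alpha\})$ and $\{f_n\}$ is a sequence such that each $|f_n|$ lies in the closure of $K_g$ in the topology of convergence in measure and $f_n\to f$ in measure, then $f\in\mathcal L^\alpha(\mathbb T)$ and $\alpha(f_n-f)\to0$; (3) $\alpha$ is strongly continuous, i.e. $\mathcal L^\alpha(\mathbb T)=L^\alpha(\mathbb T)$.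
   Context: $\mathbb T$ is the unit circle and $m$ is normalized arc length (Haar measure) on $\mathbb T$; functions equal a.e. are identified. $\mathrm{co}$ denotes convex hull, $u$ ranges over $L^\infty(\mathbb T)$, and $G_\alpha$ is the set of invertible measure-preserving maps $\varphi:\mathbb T\to\mathbb T$ such that $\alpha(h\circ\varphi)=\alpha(h)$ for all $h\in L^\infty(\mathbb T)$. For $w\in\mathbb T$, $f_w(z)=f(\overline wz)$. A continuous rotationally symmetric norm is a norm $\alpha$ on $L^\infty(\mathbb T)$ with $\alpha(1)=1$, $\alpha(|f|)=\alpha(f)$, $\alpha(f_w)=\alpha(f)$ for all $f\in L^\infty(\mathbb T)$, $w\in\mathbb T$, and $\lim_{m(E)\to0^+}\alpha(\chi_E)=0$. For any measurable $f:\mathbb T\to\mathbb C$ put $\alpha(f)=\sup\{\alpha(s):s\text{ a simple function},\ |s|\le|f|\}$. $\mathcal L^\alpha(\mathbb T)$ is the set of measurable $f$ with $\alpha(f)<\infty$, and $L^\alpha(\mathbb T)$ is the $\alpha$-closure of $L^\infty(\mathbb T)$ in $\mathcal L^\alpha(\mathbb T)$. *)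

theory Defs
  imports "HOL-Probability.Probability" "HOL-Library.Function_Algebras"
begin

section \<open>The unit circle with normalized arc length\<close>

text \<open>Functions on the circle are represented by functions on \<^typ>\<open>complex\<close>, of which only the
  values on the unit circle, up to null sets, are relevant. The measure is completed, so that
  \<open>measurable\<close> means Lebesgue measurable and is stable under a.e. equality.\<close>

abbreviation unit_circle :: "complex set" where
  "unit_circle \<equiv> sphere 0 1"

definition arc_measure :: "complex measure" where
  "arc_measure =
     completion (distr (uniform_measure lborel {0..<2 * pi}) (restrict_space borel unit_circle) cis)"

lemma space_arc_measure [simp]: "space arc_measure = unit_circle"
  by (simp add: arc_measure_def space_restrict_space)

lemma prob_space_arc_measure: "prob_space arc_measure"
proof -
  have "cis \<in> borel_measurable borel"
    by (intro borel_measurable_continuous_onI continuous_on_cis continuous_on_id)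
  then have "cis \<in> measurable (uniform_measure lborel {0..<2 * pi}) (restrict_space borel unit_circle)"
    by (intro measurable_restrict_space2) auto
  moreover have "prob_space (uniform_measure lborel {0..<2 * pi})"
    by (rule prob_space_uniform_measure) auto
  ultimately have "prob_space
      (distr (uniform_measure lborel {0..<2 * pi}) (restrict_space borel unit_circle) cis)"
    by (intro prob_space.prob_space_distr)
  then show ?thesis
    unfolding arc_measure_def by (rule prob_space.prob_space_completion)
qed

definition esssup_norm :: "(complex \<Rightarrow> complex) \<Rightarrow> ereal" where
  "esssup_norm f = esssup arc_measure (\<lambda>z. ereal (cmod (f z)))"

definition L_infty :: "(complex \<Rightarrow> complex) set" where
  "L_infty = {f \<in> borel_measurable arc_measure. esssup_norm f < \<infinity>}"

text \<open>\<^term>\<open>small_sets\<close> is the filter expressing \<open>m(E) \<rightarrow> 0\<^sup>+\<close>, where \<open>E\<close> ranges over the measurable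
  sets.\<close>

definition small_sets :: "complex set filter" where
  "small_sets = inf (filtercomap (measure arc_measure) (at_right 0)) (principal (sets arc_measure))"

lemma eventually_small_sets:
  "eventually P small_sets \<longleftrightarrow>
     (\<exists>\<delta>>0. \<forall>E\<in>sets arc_measure. 0 < measure arc_measure E \<longrightarrow> measure arc_measure E < \<delta> \<longrightarrow> P E)"
proof
  assume "eventually P small_sets"
  then obtain Q b where "\<forall>E. Q (measure arc_measure E) \<longrightarrow> E \<in> sets arc_measure \<longrightarrow> P E"
    and "0 < b" and "\<forall>y>0. y < b \<longrightarrow> Q y"
    unfolding small_sets_def eventually_inf_principal eventually_filtercomap
      eventually_at_right_field by blast
  then show "\<exists>\<delta>>0. \<forall>E\<in>sets arc_measure.
      0 < measure arc_measure E \<longrightarrow> measure arc_measure E < \<delta> \<longrightarrow> P E"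
    by blast
next
  assume "\<exists>\<delta>>0. \<forall>E\<in>sets arc_measure.
      0 < measure arc_measure E \<longrightarrow> measure arc_measure E < \<delta> \<longrightarrow> P E"
  then obtain \<delta> where "0 < \<delta>" and "\<forall>E\<in>sets arc_measure.
      0 < measure arc_measure E \<longrightarrow> measure arc_measure E < \<delta> \<longrightarrow> P E"
    by blast
  then show "eventually P small_sets"
    unfolding small_sets_def eventually_inf_principal eventually_filtercomap
      eventually_at_right_field
    by (intro exI[of _ "\<lambda>y. 0 < y \<and> y < \<delta>"]) auto
qed

section \<open>Continuous rotationally symmetric norms\<close>

text \<open>Definiteness is stated modulo null sets. Together with the triangle inequality it makes
  \<open>\<alpha>\<close> well defined on a.e. equivalence classes.\<close>

locale cont_rot_sym_norm =
  fixes \<alpha> :: "(complex \<Rightarrow> complex) \<Rightarrow> real"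
  assumes nonneg: "f \<in> L_infty \<Longrightarrow> 0 \<le> \<alpha> f"
    and eq_0_iff: "f \<in> L_infty \<Longrightarrow> \<alpha> f = 0 \<longleftrightarrow> (AE z in arc_measure. f z = 0)"
    and homogeneous: "f \<in> L_infty \<Longrightarrow> \<alpha> (\<lambda>z. c * f z) = cmod c * \<alpha> f"
    and triangle: "f \<in> L_infty \<Longrightarrow> g \<in> L_infty \<Longrightarrow> \<alpha> (\<lambda>z. f z + g z) \<le> \<alpha> f + \<alpha> g"
    and one: "\<alpha> (\<lambda>_. 1) = 1"
    and absolute: "f \<in> L_infty \<Longrightarrow> \<alpha> (\<lambda>z. complex_of_real (cmod (f z))) = \<alpha> f"
    and rotation: "f \<in> L_infty \<Longrightarrow> w \<in> unit_circle \<Longrightarrow> \<alpha> (\<lambda>z. f (cnj w * z)) = \<alpha> f"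
    and continuous: "((\<lambda>E. \<alpha> (indicator E)) \<longlongrightarrow> 0) small_sets"

definition ext_norm :: "((complex \<Rightarrow> complex) \<Rightarrow> real) \<Rightarrow> (complex \<Rightarrow> complex) \<Rightarrow> ennreal" where
  "ext_norm \<alpha> f =
     (SUP s \<in> {s. simple_function arc_measure s \<and> (AE z in arc_measure. cmod (s z) \<le> cmod (f z))}.
        ennreal (\<alpha> s))"

definition script_L :: "((complex \<Rightarrow> complex) \<Rightarrow> real) \<Rightarrow> (complex \<Rightarrow> complex) set" where
  "script_L \<alpha> = {f \<in> borel_measurable arc_measure. ext_norm \<alpha> f < \<infinity>}"

definition L_alpha :: "((complex \<Rightarrow> complex) \<Rightarrow> real) \<Rightarrow> (complex \<Rightarrow> complex) set" where
  "L_alpha \<alpha> = {f \<in> script_L \<alpha>. \<forall>\<epsilon>>0. \<exists>h\<in>L_infty. ext_norm \<alpha> (\<lambda>z. f z - h z) < \<epsilon>}"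

definition strongly_continuous :: "((complex \<Rightarrow> complex) \<Rightarrow> real) \<Rightarrow> bool" where
  "strongly_continuous \<alpha> \<longleftrightarrow> script_L \<alpha> = L_alpha \<alpha>"

section \<open>Convergence in measure\<close>

definition converges_in_measure ::
    "(nat \<Rightarrow> complex \<Rightarrow> complex) \<Rightarrow> (complex \<Rightarrow> complex) \<Rightarrow> bool" where
  "converges_in_measure F f \<longleftrightarrow>
     (\<forall>\<epsilon>>0. (\<lambda>n. measure arc_measure {z \<in> unit_circle. cmod (F n z - f z) \<ge> \<epsilon>}) \<longlonglongrightarrow> 0)"

text \<open>The sets \<^term>\<open>measure_ball f \<epsilon>\<close> with \<open>\<epsilon> > 0\<close> form a neighbourhood base at \<open>f\<close>.\<close>

definition measure_ball :: "(complex \<Rightarrow> complex) \<Rightarrow> real \<Rightarrow> (complex \<Rightarrow> complex) set" where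
  "measure_ball f \<epsilon> = {h \<in> borel_measurable arc_measure.
     measure arc_measure {z \<in> unit_circle. cmod (h z - f z) \<ge> \<epsilon>} < \<epsilon>}"

definition in_measure_topology :: "(complex \<Rightarrow> complex) topology" where
  "in_measure_topology = topology (\<lambda>U. U \<subseteq> borel_measurable arc_measure \<and>
     (\<forall>f\<in>U. \<exists>\<epsilon>>0. measure_ball f \<epsilon> \<subseteq> U))"

lemma measure_ball_mono:
  assumes "f \<in> borel_measurable arc_measure" "\<epsilon> \<le> \<delta>"
  shows "measure_ball f \<epsilon> \<subseteq> measure_ball f \<delta>"
proof
  interpret prob_space arc_measure by (rule prob_space_arc_measure)
  fix h assume h: "h \<in> measure_ball f \<epsilon>"
  then have [measurable]: "h \<in> borel_measurable arc_measure" by (simp add: measure_ball_def)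
  note [measurable] = assms(1)
  have "{z \<in> space arc_measure. cmod (h z - f z) \<ge> \<epsilon>} \<in> sets arc_measure" by measurable
  then have "measure arc_measure {z \<in> unit_circle. cmod (h z - f z) \<ge> \<delta>}
      \<le> measure arc_measure {z \<in> unit_circle. cmod (h z - f z) \<ge> \<epsilon>}"
    using assms(2) by (intro finite_measure_mono) auto
  then show "h \<in> measure_ball f \<delta>"
    using h assms(2) by (auto simp: measure_ball_def)
qed

lemma openin_in_measure_topology:
  "openin in_measure_topology U \<longleftrightarrow> U \<subseteq> borel_measurable arc_measure \<and>
     (\<forall>f\<in>U. \<exists>\<epsilon>>0. measure_ball f \<epsilon> \<subseteq> U)"
proof -
  have "istopology (\<lambda>U. U \<subseteq> borel_measurable arc_measure \<and>
     (\<forall>f\<in>U. \<exists>\<epsilon>>0. measure_ball f \<epsilon> \<subseteq> U))" (is "istopology ?P")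
    unfolding istopology_def
  proof (intro conjI allI impI)
    fix S T assume ST: "?P S" "?P T"
    then show "S \<inter> T \<subseteq> borel_measurable arc_measure" by blast
    show "\<forall>f\<in>S \<inter> T. \<exists>\<epsilon>>0. measure_ball f \<epsilon> \<subseteq> S \<inter> T"
    proof
      fix f assume f: "f \<in> S \<inter> T"
      with ST obtain a b where "a > 0" "measure_ball f a \<subseteq> S" "b > 0" "measure_ball f b \<subseteq> T"
        by blast
      moreover have "f \<in> borel_measurable arc_measure" using f ST by blast
      ultimately show "\<exists>\<epsilon>>0. measure_ball f \<epsilon> \<subseteq> S \<inter> T"
        using measure_ball_mono[of f "min a b" a] measure_ball_mono[of f "min a b" b]
        by (intro exI[of _ "min a b"]) auto
    qed
  next
    fix \<K> assume K: "\<forall>K\<in>\<K>. ?P K"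
    then show "\<Union>\<K> \<subseteq> borel_measurable arc_measure" by blast
    show "\<forall>f\<in>\<Union>\<K>. \<exists>\<epsilon>>0. measure_ball f \<epsilon> \<subseteq> \<Union>\<K>"
      using K by (meson Union_iff Union_upper subset_trans)
  qed
  then show ?thesis by (simp add: in_measure_topology_def topology_inverse')
qed

section \<open>The set dominated by a function\<close>

text \<open>The pointwise vector space structure on functions, which makes \<^const>\<open>convex\<close> and the
  convex hull available for sets of functions.\<close>

instantiation "fun" :: (type, real_vector) real_vector
begin

definition scaleR_fun :: "real \<Rightarrow> ('a \<Rightarrow> 'b) \<Rightarrow> 'a \<Rightarrow> 'b" where
  "scaleR_fun c f = (\<lambda>x. c *\<^sub>R f x)"

instance
  by standard (simp_all add: scaleR_fun_def fun_eq_iff scaleR_add_right scaleR_add_left)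

end

definition sym_group :: "((complex \<Rightarrow> complex) \<Rightarrow> real) \<Rightarrow> (complex \<Rightarrow> complex) set" where
  "sym_group \<alpha> = {\<phi>. bij_betw \<phi> unit_circle unit_circle \<and>
     \<phi> \<in> measurable arc_measure arc_measure \<and>
     inv_into unit_circle \<phi> \<in> measurable arc_measure arc_measure \<and>
     distr arc_measure arc_measure \<phi> = arc_measure \<and>
     (\<forall>h\<in>L_infty. \<alpha> (h \<circ> \<phi>) = \<alpha> h)}"

definition dominated_hull ::
    "((complex \<Rightarrow> complex) \<Rightarrow> real) \<Rightarrow> (complex \<Rightarrow> complex) \<Rightarrow> (complex \<Rightarrow> complex) set" where
  "dominated_hull \<alpha> g = convex hull
     {(\<lambda>z. complex_of_real (cmod (g (\<phi> z))) * u z) | u \<phi>.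
        u \<in> L_infty \<and> esssup_norm u \<le> 1 \<and> \<phi> \<in> sym_group \<alpha>}"

section \<open>The two convergence theorems\<close>

definition general_continuity :: "((complex \<Rightarrow> complex) \<Rightarrow> real) \<Rightarrow> bool" where
  "general_continuity \<alpha> \<longleftrightarrow>
     (\<forall>g\<in>script_L \<alpha>. ((\<lambda>E. ext_norm \<alpha> (\<lambda>z. g z * indicator E z)) \<longlongrightarrow> 0) small_sets)"

definition dominated_convergence :: "((complex \<Rightarrow> complex) \<Rightarrow> real) \<Rightarrow> bool" where
  "dominated_convergence \<alpha> \<longleftrightarrow>
     (\<forall>g\<in>script_L \<alpha>. \<forall>F f.
        (\<forall>n. F n \<in> borel_measurable arc_measure) \<longrightarrow> f \<in> borel_measurable arc_measure \<longrightarrow>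
        (\<forall>n. (\<lambda>z. complex_of_real (cmod (F n z)))
               \<in> in_measure_topology closure_of dominated_hull \<alpha> g) \<longrightarrow>
        converges_in_measure F f \<longrightarrow>
        f \<in> script_L \<alpha> \<and> (\<lambda>n. ext_norm \<alpha> (\<lambda>z. F n z - f z)) \<longlonglongrightarrow> 0)"

end

theory Submission
  imports Defs
begin

text \<open>Everything rests on the Fatou property of the extended norm with respect to convergence in
  measure, which follows from the continuity of \<open>\<alpha>\<close>. It shows that the set of those \<open>h\<close> with
  \<open>\<alpha> (h \<chi>\<^sub>E) \<le> c\<close> whenever \<open>m(E) < \<delta>\<close> is closed in measure. This set is also convex, and
  it contains \<open>|g \<circ> \<phi>| u\<close> as soon as it contains \<open>g\<close>, because \<open>\<phi>\<close> preserves both \<open>m\<close> and \<open>\<alpha>\<close>;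
  hence it contains the closure of \<open>K\<^sub>g\<close>. So under general continuity the functions
  dominated by \<open>g\<close> are uniformly absolutely continuous, and dominated convergence follows by
  splitting the circle according to the size of \<open>|f\<^sub>n - f|\<close>. Conversely, dominated convergence
  applied to the truncations of \<open>g\<close> puts \<open>g\<close> in the closure of \<open>L\<^sup>\<infinity>\<close>, and there
  general continuity is inherited from bounded functions.\<close>

interpretation arc: prob_space arc_measure
  by (rule prob_space_arc_measure)

section \<open>Essentially bounded functions and convergence in measure\<close>

lemma L_infty_measurable [measurable_dest]: "f \<in> L_infty \<Longrightarrow> f \<in> borel_measurable arc_measure"
  by (simp add: L_infty_def)

lemma L_infty_AE_bound:
  assumes "f \<in> L_infty"
  obtains C where "0 \<le> C" "AE z in arc_measure. cmod (f z) \<le> C"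
proof -
  let ?e = "esssup_norm f"
  have bound: "AE z in arc_measure. ereal (cmod (f z)) \<le> ?e"
    unfolding esssup_norm_def by (rule esssup_AE)
  have "?e < \<infinity>"
    using assms by (simp add: L_infty_def)
  then obtain C where "?e \<le> ereal C"
    by (cases ?e) auto
  have "AE z in arc_measure. cmod (f z) \<le> max 0 C"
    using bound
  proof eventually_elim
    case (elim z)
    then have "ereal (cmod (f z)) \<le> ereal C" using \<open>?e \<le> ereal C\<close> by (rule order_trans)
    then show ?case by simp
  qed
  then show thesis
    using that[of "max 0 C"] by simp
qed

lemma esssup_norm_le:
  assumes [measurable]: "f \<in> borel_measurable arc_measure"
    and "AE z in arc_measure. cmod (f z) \<le> C"
  shows "esssup_norm f \<le> ereal C"
  unfolding esssup_norm_def using assms(2) by (intro esssup_I) auto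

lemma L_inftyI:
  assumes "f \<in> borel_measurable arc_measure" "AE z in arc_measure. cmod (f z) \<le> C"
  shows "f \<in> L_infty"
  using assms esssup_norm_le[OF assms] by (auto simp: L_infty_def)

lemma simple_function_L_infty:
  assumes "simple_function arc_measure s"
  shows "s \<in> L_infty"
proof -
  have fin: "finite (s ` space arc_measure)"
    using assms by (rule simple_functionD)
  have "AE z in arc_measure. cmod (s z) \<le> Max (cmod ` s ` space arc_measure)"
    using fin by (intro AE_I2) auto
  then show ?thesis
    using assms by (intro L_inftyI) (auto intro: borel_measurable_simple_function)
qed

text \<open>Bridge between \<open>space arc_measure\<close>, the form in which measurability is
  proved automatically, and \<open>unit_circle\<close>, the form used in the definitions.\<close>

lemma sets_arc_measure_Collect:
  "{z \<in> space arc_measure. P z} \<in> sets arc_measure \<Longrightarrow> {z \<in> unit_circle. P z} \<in> sets arc_measure"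
  by simp

section \<open>The topology of convergence in measure and its sequences\<close>

lemma topspace_in_measure_topology:
  "topspace in_measure_topology = borel_measurable arc_measure"
proof
  show "topspace in_measure_topology \<subseteq> borel_measurable arc_measure"
    using openin_topspace[of in_measure_topology] by (simp only: openin_in_measure_topology)
  have "openin in_measure_topology (borel_measurable arc_measure)"
    unfolding openin_in_measure_topology
    by (auto simp: measure_ball_def intro!: exI[of _ 1])
  then show "borel_measurable arc_measure \<subseteq> topspace in_measure_topology"
    by (rule openin_subset)
qed

text \<open>Sequential closedness suffices because the balls of radius \<open>1 / Suc n\<close> are
  cofinal: if each of them around \<open>f\<close> met \<open>C\<close>, choosing a point in each
  would give a sequence in \<open>C\<close> converging in measure to \<open>f\<close>.\<close>

lemma closedin_in_measure_topologyI:
  assumes sub: "C \<subseteq> borel_measurable arc_measure"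
    and lim: "\<And>F f. (\<And>n. F n \<in> C) \<Longrightarrow> f \<in> borel_measurable arc_measure \<Longrightarrow>
      converges_in_measure F f \<Longrightarrow> f \<in> C"
  shows "closedin in_measure_topology C"
proof -
  have "\<exists>\<epsilon>>0. measure_ball f \<epsilon> \<subseteq> borel_measurable arc_measure - C"
    if f: "f \<in> borel_measurable arc_measure - C" for f
  proof (rule ccontr)
    assume "\<not> ?thesis"
    then have "\<exists>h. h \<in> measure_ball f (1 / Suc n) \<and> h \<in> C" for n
      by (auto simp: measure_ball_def subset_iff dest!: spec[of _ "1 / Suc n"])
    then obtain H where H: "\<And>n. H n \<in> measure_ball f (1 / Suc n)" "\<And>n. H n \<in> C"
      by metis
    have "converges_in_measure H f"
      unfolding converges_in_measure_def
    proof (intro allI impI)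
      fix \<epsilon> :: real assume "\<epsilon> > 0"
      have [measurable]: "f \<in> borel_measurable arc_measure" "H n \<in> borel_measurable arc_measure" for n
        using f H(1)[of n] by (auto simp: measure_ball_def)
      have sets: "{z \<in> unit_circle. c \<le> cmod (H n z - f z)} \<in> sets arc_measure" for n c
      by (rule sets_arc_measure_Collect) measurable
      \<comment> \<open>Once the radius is below \<epsilon>, the \<epsilon>-exceptional set lies in
        the one that the ball controls, whose measure is again below the radius.\<close>
      have "\<forall>\<^sub>F n in sequentially. 1 / real (Suc n) < \<epsilon>"
        using LIMSEQ_inverse_real_of_nat \<open>\<epsilon> > 0\<close>
        by (auto dest!: order_tendstoD(2) simp: inverse_eq_divide)
      then have "\<forall>\<^sub>F n in sequentially.
          measure arc_measure {z \<in> unit_circle. \<epsilon> \<le> cmod (H n z - f z)} \<le> inverse (real (Suc n))"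
      proof eventually_elim
        case (elim n)
        have "measure arc_measure {z \<in> unit_circle. \<epsilon> \<le> cmod (H n z - f z)}
            \<le> measure arc_measure {z \<in> unit_circle. 1 / Suc n \<le> cmod (H n z - f z)}"
          using elim by (intro arc.finite_measure_mono sets) auto
        also have "\<dots> \<le> inverse (real (Suc n))"
          using H(1)[of n] by (simp add: measure_ball_def inverse_eq_divide)
        finally show ?case .
      qed
      then show "(\<lambda>n. measure arc_measure {z \<in> unit_circle. \<epsilon> \<le> cmod (H n z - f z)}) \<longlonglongrightarrow> 0"
        by (intro tendsto_sandwich[OF _ _ tendsto_const LIMSEQ_inverse_real_of_nat]) auto
    qed
    with lim[of H f] H(2) f show False by blast
  qed
  then have "openin in_measure_topology (borel_measurable arc_measure - C)"
    unfolding openin_in_measure_topology by blast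
  with sub show ?thesis by (simp add: closedin_def topspace_in_measure_topology)
qed

lemma measure_tendsto_0_mono:
  assumes le: "\<And>n. measure M (A n) \<le> measure M (B n)"
    and lim: "((\<lambda>n. measure M (B n)) \<longlongrightarrow> 0) net"
  shows "((\<lambda>n. measure M (A n)) \<longlongrightarrow> 0) net"
proof (rule tendsto_sandwich[OF _ _ tendsto_const lim])
  show "\<forall>\<^sub>F n in net. 0 \<le> measure M (A n)" by simp
  show "\<forall>\<^sub>F n in net. measure M (A n) \<le> measure M (B n)" by (simp add: le)
qed

text \<open>The exceptional sets of \<open>G\<close> are contained in the measurable exceptional
  sets of \<open>F\<close>. The application is to products with a fixed indicator.\<close>

lemma converges_in_measure_mono:
  assumes "\<And>n. F n \<in> borel_measurable arc_measure" "f \<in> borel_measurable arc_measure"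
    and lim: "converges_in_measure F f"
    and le: "\<And>n z. z \<in> unit_circle \<Longrightarrow> cmod (G n z - g z) \<le> cmod (F n z - f z)"
  shows "converges_in_measure G g"
  unfolding converges_in_measure_def
proof (intro allI impI)
  fix \<epsilon> :: real assume "0 < \<epsilon>"
  note [measurable] = assms(1,2)
  have sets: "{z \<in> unit_circle. \<epsilon> \<le> cmod (F n z - f z)} \<in> sets arc_measure" for n
    by (rule sets_arc_measure_Collect) measurable
  have "measure arc_measure {z \<in> unit_circle. \<epsilon> \<le> cmod (G n z - g z)}
      \<le> measure arc_measure {z \<in> unit_circle. \<epsilon> \<le> cmod (F n z - f z)}" for n
  proof (intro arc.finite_measure_mono sets Collect_mono impI; elim conjE)
    fix z assume "z \<in> unit_circle" "\<epsilon> \<le> cmod (G n z - g z)"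
    with le[of z n] show "z \<in> unit_circle \<and> \<epsilon> \<le> cmod (F n z - f z)" by simp
  qed
  moreover have "(\<lambda>n. measure arc_measure {z \<in> unit_circle. \<epsilon> \<le> cmod (F n z - f z)}) \<longlonglongrightarrow> 0"
    using lim \<open>0 < \<epsilon>\<close> unfolding converges_in_measure_def by blast
  ultimately show
      "(\<lambda>n. measure arc_measure {z \<in> unit_circle. \<epsilon> \<le> cmod (G n z - g z)}) \<longlonglongrightarrow> 0"
    by (rule measure_tendsto_0_mono)
qed

text \<open>Tolerances for \<open>ext_norm\<close> live in \<open>ennreal\<close> and may be
  infinite; a smaller real one can be divided into parts by ordinary arithmetic.\<close>

lemma ennreal_positive_below:
  assumes "0 < (\<epsilon> :: ennreal)"
  obtains e :: real where "0 < e" "ennreal e < \<epsilon>"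
proof -
  obtain x where "0 < x" "x < \<epsilon>" using assms dense by blast
  then show thesis using that[of "enn2real x"]
    by (cases x rule: ennreal_cases) auto
qed

section \<open>The extended norm\<close>

context cont_rot_sym_norm
begin

section \<open>The norm on bounded functions: a.e. invariance, monotonicity, continuity\<close>

lemma norm_AE_0:
  assumes "f \<in> borel_measurable arc_measure" "AE z in arc_measure. f z = 0"
  shows "\<alpha> f = 0"
proof -
  have "f \<in> L_infty"
    using assms by (intro L_inftyI[where C = 0]) auto
  then show ?thesis using assms eq_0_iff by blast
qed

text \<open>The difference of the two functions has norm 0, so the triangle inequality gives both
  estimates.\<close>

lemma norm_AE_cong:
  assumes f: "f \<in> L_infty" and g: "g \<in> L_infty" and eq: "AE z in arc_measure. f z = g z"
  shows "\<alpha> f = \<alpha> g"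
proof -
  note [measurable] = L_infty_measurable[OF f] L_infty_measurable[OF g]
  have le: "\<alpha> p \<le> \<alpha> q" if "p \<in> L_infty" "q \<in> L_infty" "AE z in arc_measure. p z = q z" for p q
  proof -
    note [measurable] = L_infty_measurable[OF that(1)] L_infty_measurable[OF that(2)]
    have 0: "AE z in arc_measure. p z - q z = 0" using that(3) by auto
    then have "(\<lambda>z. p z - q z) \<in> L_infty" by (intro L_inftyI[where C = 0]) auto
    then have "\<alpha> (\<lambda>z. q z + (p z - q z)) \<le> \<alpha> q + \<alpha> (\<lambda>z. p z - q z)"
      using that by (intro triangle)
    moreover have "\<alpha> (\<lambda>z. p z - q z) = 0" using 0 by (intro norm_AE_0) auto
    ultimately show ?thesis by simp
  qed
  have "AE z in arc_measure. g z = f z" using eq by auto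
  with le[OF f g eq] le[OF g f] show ?thesis by simp
qed

text \<open>A function with values in \<open>[0, 1]\<close> is the average of two conjugate unimodular functions,
  and multiplying by those does not change \<open>\<alpha>\<close>.\<close>

lemma norm_mono:
  assumes f: "f \<in> L_infty" and g: "g \<in> L_infty"
    and le: "AE z in arc_measure. cmod (f z) \<le> cmod (g z)"
  shows "\<alpha> f \<le> \<alpha> g"
proof -
  note [measurable] = L_infty_measurable[OF f] L_infty_measurable[OF g]
  \<comment> \<open>This is the cosine of the angle by which \<open>p\<close> and \<open>q\<close>
    are turned. Where \<open>g z = 0\<close> the quotient is 0 by convention, and \<open>min\<close>
    keeps the square root real on the null set where the hypothesis may fail.\<close>
  define v where "v z = min 1 (cmod (f z) / cmod (g z))" for z
  define p where "p z = complex_of_real (cmod (g z)) *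
    (complex_of_real (v z) + \<i> * complex_of_real (sqrt (1 - (v z)\<^sup>2)))" for z
  define q where "q z = complex_of_real (cmod (g z)) *
    (complex_of_real (v z) - \<i> * complex_of_real (sqrt (1 - (v z)\<^sup>2)))" for z
  have [measurable]: "v \<in> borel_measurable arc_measure" unfolding v_def by measurable
  have [measurable]: "p \<in> borel_measurable arc_measure" "q \<in> borel_measurable arc_measure"
    unfolding p_def q_def by measurable
  have v: "0 \<le> v z" "v z \<le> 1" for z by (auto simp: v_def)
  then have v2: "(v z)\<^sup>2 \<le> 1" for z by (simp add: power_le_one)
  have cp: "cmod (p z) = cmod (g z)" and cq: "cmod (q z) = cmod (g z)" for z
  proof -
    have "cmod (complex_of_real (v z) + \<i> * complex_of_real (sqrt (1 - (v z)\<^sup>2))) = 1"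
      "cmod (complex_of_real (v z) - \<i> * complex_of_real (sqrt (1 - (v z)\<^sup>2))) = 1"
      using v2[of z] by (simp_all add: cmod_def)
    then show "cmod (p z) = cmod (g z)" "cmod (q z) = cmod (g z)"
      by (simp_all add: p_def q_def norm_mult)
  qed
  obtain C where C: "AE z in arc_measure. cmod (g z) \<le> C" using L_infty_AE_bound[OF g] by blast
  have p: "p \<in> L_infty" using C by (intro L_inftyI[where C = C]) (simp_all add: cp)
  have q: "q \<in> L_infty" using C by (intro L_inftyI[where C = C]) (simp_all add: cq)
  have eq: "AE z in arc_measure. p z + q z = 2 * complex_of_real (cmod (f z))"
    using le
  proof eventually_elim
    case (elim z)
    then have "cmod (g z) * v z = cmod (f z)"
      by (cases "g z = 0") (auto simp: v_def min_def field_simps)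
    then have "complex_of_real (cmod (g z)) * complex_of_real (v z) = complex_of_real (cmod (f z))"
      by (metis of_real_mult)
    then show ?case by (simp add: p_def q_def algebra_simps)
  qed
  obtain D where D: "AE z in arc_measure. cmod (f z) \<le> D" using L_infty_AE_bound[OF f] by blast
  have absf: "(\<lambda>z. complex_of_real (cmod (f z))) \<in> L_infty"
    using D by (intro L_inftyI[where C = D]) simp_all
  have 2: "(\<lambda>z. 2 * complex_of_real (cmod (f z))) \<in> L_infty"
    using D by (intro L_inftyI[where C = "2 * D"]) (simp_all add: norm_mult)
  have sum: "(\<lambda>z. p z + q z) \<in> L_infty"
  proof (rule L_inftyI)
    show "AE z in arc_measure. cmod (p z + q z) \<le> 2 * C"
      using C by eventually_elim (rule norm_triangle_le, simp add: cp cq)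
  qed measurable
  have "2 * \<alpha> f = \<alpha> (\<lambda>z. 2 * complex_of_real (cmod (f z)))"
    by (simp add: homogeneous[OF absf] absolute[OF f])
  also have "\<dots> = \<alpha> (\<lambda>z. p z + q z)"
    using eq by (intro norm_AE_cong 2 sum) auto
  also have "\<dots> \<le> \<alpha> p + \<alpha> q" by (intro triangle p q)
  \<comment> \<open>All of \<open>p\<close>, \<open>q\<close> and \<open>g\<close> have the same
    modulus, and \<alpha> sees only the modulus.\<close>
  also have "\<dots> = 2 * \<alpha> g"
    using absolute[OF p] absolute[OF q] absolute[OF g] by (simp add: cp cq)
  finally show ?thesis by simp
qed

lemma norm_const: "\<alpha> (\<lambda>_. c) = cmod c"
proof -
  have "(\<lambda>_. 1) \<in> L_infty" by (intro L_inftyI[where C = 1]) auto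
  from homogeneous[OF this, of c] show ?thesis by (simp add: one)
qed

text \<open>The filter \<open>small_sets\<close> sees only sets of positive measure; the indicator
  of a null set is a.e. zero and has norm 0, so null sets can be included.\<close>

lemma norm_indicator_continuous:
  assumes "0 < \<epsilon>"
  obtains \<delta> where "0 < \<delta>"
    "\<And>E. E \<in> sets arc_measure \<Longrightarrow> measure arc_measure E < \<delta> \<Longrightarrow> \<alpha> (indicator E) < \<epsilon>"
proof -
  have "eventually (\<lambda>E. \<alpha> (indicator E) < \<epsilon>) small_sets"
    using continuous assms by (rule order_tendstoD)
  then obtain \<delta> where \<delta>: "0 < \<delta>" "\<And>E. E \<in> sets arc_measure \<Longrightarrow> 0 < measure arc_measure E \<Longrightarrow>
      measure arc_measure E < \<delta> \<Longrightarrow> \<alpha> (indicator E) < \<epsilon>"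
    unfolding eventually_small_sets by blast
  have "\<alpha> (indicator E) < \<epsilon>"
    if E: "E \<in> sets arc_measure" and m: "measure arc_measure E < \<delta>" for E
  proof (cases "measure arc_measure E = 0")
    case True
    then have "AE z in arc_measure. z \<notin> E"
      using E by (intro AE_not_in) (simp add: null_sets_def arc.emeasure_eq_measure)
    then have "AE z in arc_measure. indicator E z = (0 :: complex)"
      by eventually_elim simp
    then have "\<alpha> (indicator E) = 0"
      using E by (intro norm_AE_0) simp_all
    then show ?thesis using assms by simp
  next
    case False
    then show ?thesis using \<delta>(2)[OF E] m by (simp add: zero_less_measure_iff)
  qed
  with \<delta>(1) show thesis by (rule that)
qed

section \<open>Elementary inequalities for the extended norm\<close>

lemma ext_norm_mono:
  assumes "AE z in arc_measure. cmod (f z) \<le> cmod (g z)"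
  shows "ext_norm \<alpha> f \<le> ext_norm \<alpha> g"
  unfolding ext_norm_def
proof (rule SUP_subset_mono)
  show "{s. simple_function arc_measure s \<and> (AE z in arc_measure. cmod (s z) \<le> cmod (f z))}
    \<subseteq> {s. simple_function arc_measure s \<and> (AE z in arc_measure. cmod (s z) \<le> cmod (g z))}"
  proof (intro Collect_mono impI; elim conjE; intro conjI)
    fix s :: "complex \<Rightarrow> complex" assume "AE z in arc_measure. cmod (s z) \<le> cmod (f z)"
    with assms show "AE z in arc_measure. cmod (s z) \<le> cmod (g z)"
      by eventually_elim simp
  qed
qed simp

text \<open>Each competitor in the supremum is bounded by monotonicity of \<alpha>. Together with
  \<open>norm_le_ext_norm\<close> this says that \<open>ext_norm\<close> agrees with \<alpha> on
  \<open>L_infty\<close>.\<close>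

lemma ext_norm_le_norm:
  assumes "f \<in> L_infty"
  shows "ext_norm \<alpha> f \<le> ennreal (\<alpha> f)"
  unfolding ext_norm_def
  using assms by (intro SUP_least) (auto intro!: ennreal_leI norm_mono simple_function_L_infty)

text \<open>Rounding \<open>|h|\<close> down to multiples of \<open>\<epsilon>\<close> gives a simple function below \<open>|h|\<close> which is
  \<open>\<alpha>\<close>-close to it.\<close>

lemma norm_le_ext_norm:
  assumes h: "h \<in> L_infty" and le: "AE z in arc_measure. cmod (h z) \<le> cmod (f z)"
  shows "ennreal (\<alpha> h) \<le> ext_norm \<alpha> f"
proof (rule ennreal_le_epsilon)
  fix \<epsilon> :: real assume \<epsilon>: "0 < \<epsilon>"
  note [measurable] = L_infty_measurable[OF h]
  obtain C where C: "0 \<le> C" "AE z in arc_measure. cmod (h z) \<le> C"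
    using L_infty_AE_bound[OF h] by blast
  \<comment> \<open>The bound \<open>C\<close> holds only a.e., so cutting at \<open>C\<close> is
    what leaves finitely many values of the floor, namely the integers from 0 to the floor of
    \<open>C / \<epsilon>\<close>.\<close>
  define r where "r z = \<epsilon> * of_int \<lfloor>min (cmod (h z)) C / \<epsilon>\<rfloor>" for z
  define s where "s z = complex_of_real (r z)" for z
  have [measurable]: "r \<in> borel_measurable arc_measure" unfolding r_def by measurable
  have [measurable]: "s \<in> borel_measurable arc_measure" unfolding s_def by measurable
  have r0: "0 \<le> r z" for z using \<epsilon> C(1) by (auto simp: r_def)
  have r1: "r z \<le> min (cmod (h z)) C" for z
  proof -
    have "of_int \<lfloor>min (cmod (h z)) C / \<epsilon>\<rfloor> \<le> min (cmod (h z)) C / \<epsilon>" by (rule of_int_floor_le)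
    then have "of_int \<lfloor>min (cmod (h z)) C / \<epsilon>\<rfloor> * \<epsilon> \<le> min (cmod (h z)) C"
      using \<epsilon> by (simp only: pos_le_divide_eq)
    then show ?thesis by (simp only: r_def mult.commute)
  qed
  have r2: "min (cmod (h z)) C - r z \<le> \<epsilon>" for z
  proof -
    have "min (cmod (h z)) C / \<epsilon> \<le> of_int \<lfloor>min (cmod (h z)) C / \<epsilon>\<rfloor> + 1" by linarith
    then show ?thesis using \<epsilon> by (simp add: r_def pos_divide_le_eq algebra_simps)
  qed
  have "s ` space arc_measure \<subseteq> (\<lambda>k. complex_of_real (\<epsilon> * of_int k)) ` {0..\<lfloor>C / \<epsilon>\<rfloor>}"
    using \<epsilon> C(1) by (auto simp: s_def r_def intro!: imageI floor_mono divide_right_mono)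
  then have "finite (s ` space arc_measure)" by (rule finite_subset) simp
  then have simple: "simple_function arc_measure s"
    by (intro simple_function_borel_measurable) simp_all
  then have s: "s \<in> L_infty" by (rule simple_function_L_infty)
  define d where "d z = complex_of_real (cmod (h z)) - s z" for z
  have [measurable]: "d \<in> borel_measurable arc_measure" unfolding d_def by measurable
  have d_le: "AE z in arc_measure. cmod (d z) \<le> \<epsilon>"
    using C(2)
  proof eventually_elim
    case (elim z)
    have "d z = complex_of_real (cmod (h z) - r z)" by (simp add: d_def s_def)
    then have "cmod (d z) = \<bar>cmod (h z) - r z\<bar>" by (metis norm_of_real)
    then show ?case using r1[of z] r2[of z] elim by auto
  qed
  then have d: "d \<in> L_infty" by (intro L_inftyI[where C = \<epsilon>]) simp_all
  have "\<alpha> h = \<alpha> (\<lambda>z. s z + d z)" using absolute[OF h] by (simp add: d_def)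
  also have "\<dots> \<le> \<alpha> s + \<alpha> d" by (intro triangle s d)
  also have "\<alpha> d \<le> \<alpha> (\<lambda>_. complex_of_real \<epsilon>)"
    using d_le \<epsilon> by (intro norm_mono d L_inftyI[where C = \<epsilon>]) auto
  also have "\<dots> = \<epsilon>" using \<epsilon> by (simp add: norm_const)
  finally have "\<alpha> h \<le> \<alpha> s + \<epsilon>" by simp
  then have "ennreal (\<alpha> h) \<le> ennreal (\<alpha> s) + ennreal \<epsilon>"
    using nonneg[OF s] \<epsilon> by (simp flip: ennreal_plus)
  also have "ennreal (\<alpha> s) \<le> ext_norm \<alpha> f"
    unfolding ext_norm_def
  proof (intro SUP_upper CollectI conjI simple)
    show "AE z in arc_measure. cmod (s z) \<le> cmod (f z)"
      using le
    proof eventually_elim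
      case (elim z)
      have "cmod (s z) = r z" using r0[of z] by (simp add: s_def)
      with elim r1[of z] show ?case by simp
    qed
  qed
  finally show "ennreal (\<alpha> h) \<le> ext_norm \<alpha> f + ennreal \<epsilon>" by simp
qed

text \<open>A simple \<open>s\<close> with \<open>|s| \<le> |f + g|\<close> is split in proportion to \<open>|f|\<close> and \<open>|g|\<close>.\<close>

lemma ext_norm_triangle:
  assumes [measurable]: "f \<in> borel_measurable arc_measure" "g \<in> borel_measurable arc_measure"
  shows "ext_norm \<alpha> (\<lambda>z. f z + g z) \<le> ext_norm \<alpha> f + ext_norm \<alpha> g"
  unfolding ext_norm_def[of _ "\<lambda>z. f z + g z"]
proof (rule SUP_least, clarify)
  fix s assume simple: "simple_function arc_measure s"
    and le: "AE z in arc_measure. cmod (s z) \<le> cmod (f z + g z)"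
  have s: "s \<in> L_infty" using simple by (rule simple_function_L_infty)
  note [measurable] = L_infty_measurable[OF s]
  obtain C where C: "AE z in arc_measure. cmod (s z) \<le> C" using L_infty_AE_bound[OF s] by blast
  \<comment> \<open>The common factor of proportionality. It is 0 where \<open>f\<close> and
    \<open>g\<close> both vanish, which is harmless because \<open>s\<close> vanishes there
    a.e.\<close>
  define t where "t z = cmod (s z) / (cmod (f z) + cmod (g z))" for z
  define p where "p z = complex_of_real (t z * cmod (f z))" for z
  define q where "q z = complex_of_real (t z * cmod (g z))" for z
  have [measurable]: "t \<in> borel_measurable arc_measure" unfolding t_def by measurable
  have [measurable]: "p \<in> borel_measurable arc_measure" "q \<in> borel_measurable arc_measure"
    unfolding p_def q_def by measurable
  have t: "AE z in arc_measure. 0 \<le> t z \<and> t z \<le> 1"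
    using le
  proof eventually_elim
    case (elim z)
    have *: "cmod (s z) \<le> cmod (f z) + cmod (g z)"
      using elim norm_triangle_ineq order_trans by blast
    show ?case
    proof (cases "cmod (f z) + cmod (g z) = 0")
      case True
      then show ?thesis by (simp add: t_def)
    next
      case False
      then have "0 < cmod (f z) + cmod (g z)" by (metis add_nonneg_nonneg less_le norm_ge_zero)
      then show ?thesis using * by (simp add: t_def divide_le_eq_1_pos)
    qed
  qed
  have pf: "AE z in arc_measure. cmod (p z) \<le> cmod (f z)"
    using t by eventually_elim (simp add: p_def norm_mult mult_left_le_one_le)
  have qg: "AE z in arc_measure. cmod (q z) \<le> cmod (g z)"
    using t by eventually_elim (simp add: q_def norm_mult mult_left_le_one_le)
  have sum: "AE z in arc_measure. t z * cmod (f z) + t z * cmod (g z) = cmod (s z)"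
    using le
  proof eventually_elim
    case (elim z)
    show ?case
    proof (cases "cmod (f z) + cmod (g z) = 0")
      case True
      then have "f z = 0" "g z = 0" by (auto simp: add_nonneg_eq_0_iff)
      then show ?thesis using elim by simp
    next
      case False
      then have "t z * (cmod (f z) + cmod (g z)) = cmod (s z)" by (simp add: t_def)
      then show ?thesis by (simp only: distrib_left)
    qed
  qed
  \<comment> \<open>Both pieces are a.e. nonnegative and add up to \<open>|s|\<close>, so they
    inherit the bound \<open>C\<close> although \<open>f\<close> and \<open>g\<close> may be
    unbounded.\<close>
  have p: "p \<in> L_infty"
  proof (rule L_inftyI)
    show "AE z in arc_measure. cmod (p z) \<le> C"
      using t sum C
    proof eventually_elim
      case (elim z)
      have "0 \<le> t z * cmod (f z)" "0 \<le> t z * cmod (g z)" using elim by auto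
      moreover have "cmod (p z) = t z * cmod (f z)" using elim by (simp add: p_def norm_mult)
      ultimately show ?case using elim by linarith
    qed
  qed measurable
  have q: "q \<in> L_infty"
  proof (rule L_inftyI)
    show "AE z in arc_measure. cmod (q z) \<le> C"
      using t sum C
    proof eventually_elim
      case (elim z)
      have "0 \<le> t z * cmod (f z)" "0 \<le> t z * cmod (g z)" using elim by auto
      moreover have "cmod (q z) = t z * cmod (g z)" using elim by (simp add: q_def norm_mult)
      ultimately show ?case using elim by linarith
    qed
  qed measurable
  have pq: "AE z in arc_measure. p z + q z = complex_of_real (cmod (s z))"
    using sum by eventually_elim (simp only: p_def q_def of_real_add[symmetric])
  have "\<alpha> s = \<alpha> (\<lambda>z. complex_of_real (cmod (s z)))" by (simp add: absolute[OF s])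
  also have "\<dots> = \<alpha> (\<lambda>z. p z + q z)"
  proof (rule norm_AE_cong)
    show "(\<lambda>z. complex_of_real (cmod (s z))) \<in> L_infty" using C by (intro L_inftyI[where C = C]) simp_all
    show "(\<lambda>z. p z + q z) \<in> L_infty"
    proof (rule L_inftyI)
      show "AE z in arc_measure. cmod (p z + q z) \<le> C"
        using C pq by eventually_elim simp
    qed measurable
    show "AE z in arc_measure. complex_of_real (cmod (s z)) = p z + q z" using pq by auto
  qed
  also have "\<dots> \<le> \<alpha> p + \<alpha> q" by (intro triangle p q)
  finally have "ennreal (\<alpha> s) \<le> ennreal (\<alpha> p) + ennreal (\<alpha> q)"
    using nonneg[OF p] nonneg[OF q] by (simp flip: ennreal_plus)
  also have "\<dots> \<le> ext_norm \<alpha> f + ext_norm \<alpha> g"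
    by (intro add_mono norm_le_ext_norm p q pf qg)
  finally show "ennreal (\<alpha> s) \<le> ext_norm \<alpha> f + ext_norm \<alpha> g" .
qed

text \<open>The triangle inequality is applied to the moduli, whose sum dominates \<open>h\<close>.
  This form handles estimates in which \<open>h\<close> is split differently on different parts of
  the circle.\<close>

lemma ext_norm_dominated_sum:
  assumes "f \<in> borel_measurable arc_measure" "g \<in> borel_measurable arc_measure"
    and "\<And>z. z \<in> unit_circle \<Longrightarrow> cmod (h z) \<le> cmod (f z) + cmod (g z)"
  shows "ext_norm \<alpha> h \<le> ext_norm \<alpha> f + ext_norm \<alpha> g"
proof -
  note [measurable] = assms(1,2)
  have "ext_norm \<alpha> h
      \<le> ext_norm \<alpha> (\<lambda>z. complex_of_real (cmod (f z)) + complex_of_real (cmod (g z)))"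
    using assms(3) by (intro ext_norm_mono AE_I2) (simp flip: of_real_add)
  also have "\<dots> \<le> ext_norm \<alpha> (\<lambda>z. complex_of_real (cmod (f z)))
      + ext_norm \<alpha> (\<lambda>z. complex_of_real (cmod (g z)))"
    by (intro ext_norm_triangle) auto
  also have "\<dots> \<le> ext_norm \<alpha> f + ext_norm \<alpha> g"
    by (intro add_mono ext_norm_mono) auto
  finally show ?thesis .
qed

text \<open>Dividing a competitor for \<open>c * f\<close> by \<open>c\<close> gives a competitor
  for \<open>f\<close>.\<close>

lemma ext_norm_mult_le:
  "ext_norm \<alpha> (\<lambda>z. c * f z) \<le> ennreal (cmod c) * ext_norm \<alpha> f"
  unfolding ext_norm_def[of _ "\<lambda>z. c * f z"]
proof (rule SUP_least, clarify)
  fix s assume simple: "simple_function arc_measure s"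
    and le: "AE z in arc_measure. cmod (s z) \<le> cmod (c * f z)"
  have s: "s \<in> L_infty" using simple by (rule simple_function_L_infty)
  note [measurable] = L_infty_measurable[OF s]
  show "ennreal (\<alpha> s) \<le> ennreal (cmod c) * ext_norm \<alpha> f"
  \<comment> \<open>The right side is 0 for \<open>c = 0\<close> even if
    \<open>ext_norm \<alpha> f\<close> is infinite, but then \<open>s\<close> vanishes a.e.\<close>
  proof (cases "c = 0")
    case True
    then have "AE z in arc_measure. s z = 0" using le by auto
    then have "\<alpha> s = 0" by (intro norm_AE_0) auto
    then show ?thesis by simp
  next
    case False
    define r where "r z = s z / c" for z
    have [measurable]: "r \<in> borel_measurable arc_measure" unfolding r_def by measurable
    have "simple_function arc_measure ((\<lambda>x. x / c) \<circ> s)" using simple by simp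
    then have r: "r \<in> L_infty"
      by (intro simple_function_L_infty) (simp add: r_def[abs_def] comp_def)
    have "\<alpha> s = cmod c * \<alpha> r"
      using homogeneous[OF r, of c] False by (simp add: r_def)
    moreover have "ennreal (\<alpha> r) \<le> ext_norm \<alpha> f"
    proof (rule norm_le_ext_norm[OF r])
      show "AE z in arc_measure. cmod (r z) \<le> cmod (f z)"
        using le
        by eventually_elim (use False in \<open>simp add: r_def norm_divide norm_mult divide_le_eq mult.commute\<close>)
    qed
    ultimately show ?thesis using nonneg[OF r] by (simp add: ennreal_mult mult_left_mono)
  qed
qed

lemma ext_norm_const_le: "ext_norm \<alpha> (\<lambda>_. c) \<le> ennreal (cmod c)"
  using ext_norm_le_norm[of "\<lambda>_. c"] by (simp add: norm_const L_inftyI[where C = "cmod c"])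

text \<open>Fatou property: below a simple \<open>s\<close> with \<open>|s| \<le> |f|\<close>, the functions \<open>min |s| |F n|\<close> converge
  to \<open>|s|\<close> boundedly and in measure, hence in \<open>\<alpha>\<close>.\<close>

lemma ext_norm_le_of_converges_in_measure:
  assumes F: "\<And>n. F n \<in> borel_measurable arc_measure" and f: "f \<in> borel_measurable arc_measure"
    and lim: "converges_in_measure F f" and bound: "\<And>n. ext_norm \<alpha> (F n) \<le> c"
  shows "ext_norm \<alpha> f \<le> c"
  unfolding ext_norm_def
proof (rule SUP_least, clarify)
  note [measurable] = F f
  fix s assume simple: "simple_function arc_measure s"
    and le: "AE z in arc_measure. cmod (s z) \<le> cmod (f z)"
  have s: "s \<in> L_infty" using simple by (rule simple_function_L_infty)
  note [measurable] = L_infty_measurable[OF s]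
  obtain C where C: "0 \<le> C" "AE z in arc_measure. cmod (s z) \<le> C"
    using L_infty_AE_bound[OF s] by blast
  show "ennreal (\<alpha> s) \<le> c"
  proof (rule ennreal_le_epsilon)
    fix \<epsilon> :: real assume \<epsilon>: "0 < \<epsilon>"
    \<comment> \<open>Half of \<epsilon> is reserved for the exceptional set, where the error is at
      most \<open>C\<close>; using \<open>C + 1\<close> keeps the denominator positive when
      \<open>C = 0\<close>.\<close>
    have "0 < \<epsilon> / (2 * (C + 1))" using \<epsilon> C(1) by simp
    then obtain \<delta> where \<delta>: "0 < \<delta>" "\<And>E. E \<in> sets arc_measure \<Longrightarrow> measure arc_measure E < \<delta> \<Longrightarrow>
        \<alpha> (indicator E) < \<epsilon> / (2 * (C + 1))"
      using norm_indicator_continuous by metis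
    have "(\<lambda>n. measure arc_measure {z \<in> unit_circle. \<epsilon> / 2 \<le> cmod (F n z - f z)}) \<longlonglongrightarrow> 0"
      using lim \<epsilon> unfolding converges_in_measure_def by (meson half_gt_zero)
    \<comment> \<open>A single index is enough, since the bound \<open>c\<close> is the same for all
      \<open>n\<close>.\<close>
    from order_tendstoD(2)[OF this \<delta>(1)]
    obtain n where n: "measure arc_measure {z \<in> unit_circle. \<epsilon> / 2 \<le> cmod (F n z - f z)} < \<delta>"
      by (auto simp: eventually_sequentially)
    define E where "E = {z \<in> unit_circle. \<epsilon> / 2 \<le> cmod (F n z - f z)}"
    have "{z \<in> space arc_measure. \<epsilon> / 2 \<le> cmod (F n z - f z)} \<in> sets arc_measure" by measurable
    then have E [measurable]: "E \<in> sets arc_measure" by (simp add: E_def)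
    define h where "h z = complex_of_real (min (cmod (s z)) (cmod (F n z)))" for z
    define d where "d z = complex_of_real (cmod (s z)) - h z" for z
    have [measurable]: "h \<in> borel_measurable arc_measure" unfolding h_def by measurable
    have [measurable]: "d \<in> borel_measurable arc_measure" unfolding d_def by measurable
    have h: "h \<in> L_infty"
    proof (rule L_inftyI)
      show "AE z in arc_measure. cmod (h z) \<le> C"
        using C(2) by eventually_elim (simp add: h_def)
    qed measurable
    have d_eq: "cmod (d z) = cmod (s z) - min (cmod (s z)) (cmod (F n z))" for z
    proof -
      have "d z = complex_of_real (cmod (s z) - min (cmod (s z)) (cmod (F n z)))"
        by (simp add: d_def h_def)
      then show ?thesis by (simp only: norm_of_real)
    qed
    have d: "d \<in> L_infty"
    proof (rule L_inftyI)
      show "AE z in arc_measure. cmod (d z) \<le> C"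
        using C(2)
      proof eventually_elim
        case (elim z)
        have "0 \<le> min (cmod (s z)) (cmod (F n z))" by simp
        with elim show ?case by (simp only: d_eq)
      qed
    qed measurable
    have ind: "(indicator E :: complex \<Rightarrow> complex) \<in> L_infty"
      by (intro L_inftyI[where C = 1]) (auto simp: indicator_def)
    have Cind: "(\<lambda>z. complex_of_real C * indicator E z) \<in> L_infty"
      using C(1) by (intro L_inftyI[where C = C]) (auto simp: indicator_def)
    have const: "(\<lambda>_. complex_of_real (\<epsilon> / 2)) \<in> L_infty"
      using \<epsilon> by (intro L_inftyI[where C = "\<epsilon> / 2"]) auto
    have sum: "(\<lambda>z. complex_of_real (\<epsilon> / 2) + complex_of_real C * indicator E z) \<in> L_infty"
      using \<epsilon> C(1) by (intro L_inftyI[where C = "\<epsilon> / 2 + C"] AE_I2)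
        (auto intro!: norm_triangle_le simp: indicator_def)
    \<comment> \<open>On \<open>E\<close> the error is at most \<open>|s|\<close>, hence at most
      \<open>C\<close>. Off \<open>E\<close> it is at most \<epsilon>/2, because \<open>|s|\<close>
      is at most \<open>|f|\<close> and \<open>|f|\<close> is less than
      \<open>|F n| + \<epsilon> / 2\<close>.\<close>
    have "AE z in arc_measure. cmod (d z)
        \<le> cmod (complex_of_real (\<epsilon> / 2) + complex_of_real C * indicator E z)"
      using le C(2) AE_space
    proof eventually_elim
      case (elim z)
      have *: "complex_of_real (\<epsilon> / 2) + complex_of_real C * indicator E z
          = complex_of_real (\<epsilon> / 2 + C * indicator E z)"
        by (simp add: indicator_def)
      have **: "cmod (complex_of_real (\<epsilon> / 2) + complex_of_real C * indicator E z)
          = \<epsilon> / 2 + C * indicator E z"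
        unfolding * norm_of_real using \<epsilon> C(1) by (simp add: indicator_def)
      show ?case
      proof (cases "z \<in> E")
        case True
        have "0 \<le> min (cmod (s z)) (cmod (F n z))" by simp
        then have "cmod (s z) - min (cmod (s z)) (cmod (F n z)) \<le> \<epsilon> / 2 + C"
          using elim \<epsilon> by linarith
        then show ?thesis unfolding ** d_eq using True by simp
      next
        case False
        then have "cmod (F n z - f z) < \<epsilon> / 2" using elim by (auto simp: E_def)
        then have "cmod (f z) - cmod (F n z) < \<epsilon> / 2"
          using norm_triangle_ineq2[of "f z" "F n z"] by (simp add: norm_minus_commute)
        then show ?thesis unfolding ** d_eq using False elim \<epsilon> by (simp add: min_def)
      qed
    qed
    then have "\<alpha> d \<le> \<alpha> (\<lambda>z. complex_of_real (\<epsilon> / 2) + complex_of_real C * indicator E z)"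
      by (intro norm_mono d sum)
    also have "\<dots> \<le> \<alpha> (\<lambda>_. complex_of_real (\<epsilon> / 2)) + \<alpha> (\<lambda>z. complex_of_real C * indicator E z)"
      by (intro triangle const Cind)
    also have "\<dots> = \<epsilon> / 2 + C * \<alpha> (indicator E)"
      using \<epsilon> C(1) by (simp add: norm_const homogeneous[OF ind])
    also have "C * \<alpha> (indicator E) \<le> (C + 1) * (\<epsilon> / (2 * (C + 1)))"
      using \<delta>(2)[OF E] n C(1) nonneg[OF ind] by (intro mult_mono) (auto simp: E_def)
    also have "\<dots> = \<epsilon> / 2" using C(1) by (simp add: field_simps)
    finally have "\<alpha> d \<le> \<epsilon>" by simp
    moreover have "\<alpha> s \<le> \<alpha> h + \<alpha> d"
      using triangle[OF h d] absolute[OF s] by (simp add: d_def)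
    ultimately have "ennreal (\<alpha> s) \<le> ennreal (\<alpha> h) + ennreal \<epsilon>"
      using nonneg[OF h] \<epsilon> by (simp flip: ennreal_plus)
    also have "ennreal (\<alpha> h) \<le> ext_norm \<alpha> (F n)"
      by (intro norm_le_ext_norm h) (simp add: h_def)
    also have "\<dots> \<le> c" by (rule bound)
    finally show "ennreal (\<alpha> s) \<le> c + ennreal \<epsilon>" by simp
  qed
qed

section \<open>The dominated hull\<close>

definition small_on_small_sets :: "real \<Rightarrow> ennreal \<Rightarrow> (complex \<Rightarrow> complex) set" where
  "small_on_small_sets \<delta> c = {h \<in> borel_measurable arc_measure.
     \<forall>E\<in>sets arc_measure. measure arc_measure E < \<delta> \<longrightarrow>
       ext_norm \<alpha> (\<lambda>z. h z * indicator E z) \<le> c}"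

lemma small_on_small_sets_measurable:
  "h \<in> small_on_small_sets \<delta> c \<Longrightarrow> h \<in> borel_measurable arc_measure"
  by (simp add: small_on_small_sets_def)

lemma small_on_small_setsD:
  "h \<in> small_on_small_sets \<delta> c \<Longrightarrow> E \<in> sets arc_measure \<Longrightarrow> measure arc_measure E < \<delta> \<Longrightarrow>
    ext_norm \<alpha> (\<lambda>z. h z * indicator E z) \<le> c"
  by (simp add: small_on_small_sets_def)

text \<open>Dominated convergence places only the moduli \<open>|F n|\<close> in the closure of the
  hull; since \<open>ext_norm\<close> depends only on the modulus, the bounds pass to
  \<open>F n\<close>.\<close>

lemma small_on_small_sets_abs_iff:
  assumes "h \<in> borel_measurable arc_measure"
  shows "(\<lambda>z. complex_of_real (cmod (h z))) \<in> small_on_small_sets \<delta> c \<longleftrightarrow>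
    h \<in> small_on_small_sets \<delta> c"
proof -
  note [measurable] = assms
  have "ext_norm \<alpha> (\<lambda>z. complex_of_real (cmod (h z)) * indicator E z)
      = ext_norm \<alpha> (\<lambda>z. h z * indicator E z)" for E
    by (intro antisym ext_norm_mono AE_I2) (auto simp: norm_mult)
  then show ?thesis by (simp add: small_on_small_sets_def)
qed

text \<open>The circle has measure 1, so it is itself an admissible set, and all other sets give
  smaller values.\<close>

lemma ext_norm_le_iff_small_on_small_sets:
  assumes "h \<in> borel_measurable arc_measure" "\<delta> > 1"
  shows "h \<in> small_on_small_sets \<delta> c \<longleftrightarrow> ext_norm \<alpha> h \<le> c"
proof
  assume "h \<in> small_on_small_sets \<delta> c"
  then have "ext_norm \<alpha> (\<lambda>z. h z * indicator unit_circle z) \<le> c"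
    using assms(2) sets.top[of arc_measure] arc.prob_space
    by (intro small_on_small_setsD) auto
  moreover have "ext_norm \<alpha> h \<le> ext_norm \<alpha> (\<lambda>z. h z * indicator unit_circle z)"
    by (intro ext_norm_mono AE_I2) (auto simp: indicator_def)
  ultimately show "ext_norm \<alpha> h \<le> c" by simp
next
  assume le: "ext_norm \<alpha> h \<le> c"
  have "ext_norm \<alpha> (\<lambda>z. h z * indicator E z) \<le> c" for E
    using le by (rule order_trans[OF ext_norm_mono, rotated]) (auto simp: indicator_def)
  with assms(1) show "h \<in> small_on_small_sets \<delta> c" by (simp add: small_on_small_sets_def)
qed

text \<open>For each fixed \<open>E\<close>, multiplying by its indicator preserves convergence in
  measure, and the Fatou property keeps the bound.\<close>

lemma small_on_small_sets_limit:
  assumes F: "\<And>n. F n \<in> small_on_small_sets \<delta> c" and f: "f \<in> borel_measurable arc_measure"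
    and lim: "converges_in_measure F f"
  shows "f \<in> small_on_small_sets \<delta> c"
  unfolding small_on_small_sets_def
proof (intro CollectI conjI ballI impI f)
  fix E assume E [measurable]: "E \<in> sets arc_measure" and m: "measure arc_measure E < \<delta>"
  note [measurable] = f small_on_small_sets_measurable[OF F]
  show "ext_norm \<alpha> (\<lambda>z. f z * indicator E z) \<le> c"
  proof (rule ext_norm_le_of_converges_in_measure[where F = "\<lambda>n z. F n z * indicator E z"])
    show "ext_norm \<alpha> (\<lambda>z. F n z * indicator E z) \<le> c" for n
      using F E m by (rule small_on_small_setsD)
    show "converges_in_measure (\<lambda>n z. F n z * indicator E z) (\<lambda>z. f z * indicator E z)"
      by (rule converges_in_measure_mono[OF small_on_small_sets_measurable[OF F] f lim])
        (simp add: indicator_def)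
  qed measurable
qed

text \<open>For each \<open>E\<close> the condition bounds a subadditive, homogeneous quantity by a
  constant, and the weights add up to 1.\<close>

lemma convex_small_on_small_sets: "convex (small_on_small_sets \<delta> c)"
proof (rule convexI)
  fix x y :: "complex \<Rightarrow> complex" and a b :: real
  assume x: "x \<in> small_on_small_sets \<delta> c" and y: "y \<in> small_on_small_sets \<delta> c"
    and ab: "0 \<le> a" "0 \<le> b" "a + b = 1"
  note [measurable] = small_on_small_sets_measurable[OF x] small_on_small_sets_measurable[OF y]
  have eq: "a *\<^sub>R x + b *\<^sub>R y = (\<lambda>z. complex_of_real a * x z + complex_of_real b * y z)"
    by (simp add: fun_eq_iff scaleR_fun_def scaleR_conv_of_real)
  show "a *\<^sub>R x + b *\<^sub>R y \<in> small_on_small_sets \<delta> c"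
    unfolding eq small_on_small_sets_def
  proof (intro CollectI conjI ballI impI)
    fix E assume E [measurable]: "E \<in> sets arc_measure" and m: "measure arc_measure E < \<delta>"
    have "ext_norm \<alpha> (\<lambda>z. (complex_of_real a * x z + complex_of_real b * y z) * indicator E z)
        = ext_norm \<alpha> (\<lambda>z. complex_of_real a * (x z * indicator E z)
            + complex_of_real b * (y z * indicator E z))"
      by (simp add: algebra_simps)
    also have "\<dots> \<le> ext_norm \<alpha> (\<lambda>z. complex_of_real a * (x z * indicator E z))
        + ext_norm \<alpha> (\<lambda>z. complex_of_real b * (y z * indicator E z))"
      by (intro ext_norm_triangle) measurable
    also have "\<dots> \<le> ennreal a * ext_norm \<alpha> (\<lambda>z. x z * indicator E z)
        + ennreal b * ext_norm \<alpha> (\<lambda>z. y z * indicator E z)"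
      using ab by (intro add_mono order_trans[OF ext_norm_mult_le]) auto
    also have "\<dots> \<le> ennreal a * c + ennreal b * c"
      using x y E m by (intro add_mono mult_left_mono small_on_small_setsD) auto
    also have "\<dots> = ennreal (a + b) * c"
      by (simp only: ennreal_plus[OF ab(1,2)] distrib_right)
    also have "\<dots> = c" using ab by simp
    finally show "ext_norm \<alpha> (\<lambda>z. (complex_of_real a * x z + complex_of_real b * y z)
        * indicator E z) \<le> c" .
  qed measurable
qed

text \<open>The set \<open>E'\<close> is the image of \<open>E\<close> under \<open>\<phi>\<close>.
  A competitor \<open>s\<close> on \<open>E\<close> is transported to \<open>s\<close> composed with
  the inverse of \<open>\<phi>\<close>, a competitor on \<open>E'\<close> of equal norm by the
  invariance of \<alpha>.\<close>

lemma ext_norm_sym_le: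
  assumes g: "g \<in> borel_measurable arc_measure" and \<phi>: "\<phi> \<in> sym_group \<alpha>"
    and E: "E \<in> sets arc_measure"
  shows "\<exists>E'\<in>sets arc_measure. measure arc_measure E' = measure arc_measure E \<and>
    ext_norm \<alpha> (\<lambda>z. g (\<phi> z) * indicator E z) \<le> ext_norm \<alpha> (\<lambda>z. g z * indicator E' z)"
proof -
  define \<psi> where "\<psi> = inv_into unit_circle \<phi>"
  have bij: "bij_betw \<phi> unit_circle unit_circle"
    and m [measurable]: "\<phi> \<in> measurable arc_measure arc_measure"
      "\<psi> \<in> measurable arc_measure arc_measure"
    and distr: "distr arc_measure arc_measure \<phi> = arc_measure"
    and inv: "\<And>h. h \<in> L_infty \<Longrightarrow> \<alpha> (h \<circ> \<phi>) = \<alpha> h"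
    using \<phi> by (auto simp: sym_group_def \<psi>_def)
  note [measurable] = g E
  have \<psi>\<phi>: "\<psi> (\<phi> z) = z" if "z \<in> unit_circle" for z
    using bij that by (auto simp: \<psi>_def bij_betw_def)
  have \<phi>_in: "\<phi> z \<in> unit_circle" if "z \<in> unit_circle" for z
    using bij that by (auto simp: bij_betw_def)
  \<comment> \<open>Writing the image as a preimage under the measurable inverse makes its
    measurability immediate.\<close>
  define E' where "E' = \<psi> -` E \<inter> space arc_measure"
  have E' [measurable]: "E' \<in> sets arc_measure" unfolding E'_def by measurable
  have Esub: "E \<subseteq> unit_circle" using sets.sets_into_space[OF E] by simp
  have "\<phi> -` E' \<inter> space arc_measure = E"
    using \<psi>\<phi> \<phi>_in Esub by (auto simp: E'_def)
  then have "measure arc_measure E = measure (distr arc_measure arc_measure \<phi>) E'"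
    by (subst measure_distr) auto
  then have meas: "measure arc_measure E' = measure arc_measure E" by (simp add: distr)
  have "ext_norm \<alpha> (\<lambda>z. g (\<phi> z) * indicator E z) \<le> ext_norm \<alpha> (\<lambda>z. g z * indicator E' z)"
    unfolding ext_norm_def[of _ "\<lambda>z. g (\<phi> z) * indicator E z"]
  proof (rule SUP_least, clarify)
    fix s assume simple: "simple_function arc_measure s"
      and le: "AE z in arc_measure. cmod (s z) \<le> cmod (g (\<phi> z) * indicator E z)"
    have s: "s \<in> L_infty" using simple by (rule simple_function_L_infty)
    note [measurable] = L_infty_measurable[OF s]
    define t where "t z = s (\<psi> z)" for z
    have [measurable]: "t \<in> borel_measurable arc_measure" unfolding t_def by measurable
    have t\<phi>: "t (\<phi> z) = s z" if "z \<in> unit_circle" for z using \<psi>\<phi>[OF that] by (simp add: t_def)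
    have fin: "finite (s ` space arc_measure)" using simple by (rule simple_functionD)
    have "t ` space arc_measure \<subseteq> s ` space arc_measure"
      using measurable_space[OF m(2)] by (auto simp: t_def)
    then have "simple_function arc_measure t"
      using fin by (intro simple_function_borel_measurable) (simp_all add: finite_subset)
    then have t: "t \<in> L_infty" by (rule simple_function_L_infty)
    have "AE z in arc_measure. cmod (t (\<phi> z)) \<le> cmod (g (\<phi> z) * indicator E' (\<phi> z))"
      using le AE_space
    proof eventually_elim
      case (elim z)
      have "indicator E' (\<phi> z) = (indicator E z :: complex)"
        using elim \<psi>\<phi> \<phi>_in by (auto simp: E'_def indicator_def)
      then show ?case using elim t\<phi> by simp
    qed
    moreover have "{z \<in> space arc_measure. cmod (t z) \<le> cmod (g z * indicator E' z)} \<in> sets arc_measure"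
      by measurable
    \<comment> \<open>Because \<open>\<phi>\<close> carries the measure to itself, what holds a.e.
      at \<open>\<phi> z\<close> holds a.e. at \<open>z\<close>.\<close>
    ultimately have "AE z in arc_measure. cmod (t z) \<le> cmod (g z * indicator E' z)"
      by (rule AE_distr_iff[OF m(1), unfolded distr, THEN iffD2, rotated])
    then have "ennreal (\<alpha> t) \<le> ext_norm \<alpha> (\<lambda>z. g z * indicator E' z)"
      by (intro norm_le_ext_norm t)
    \<comment> \<open>The two functions are known to agree on the circle only, hence the appeal to
      a.e. invariance.\<close>
    moreover have "\<alpha> s = \<alpha> (t \<circ> \<phi>)"
    proof (rule norm_AE_cong[OF s])
      obtain C where C: "AE z in arc_measure. cmod (s z) \<le> C"
        using L_infty_AE_bound[OF s] by blast
      have "AE z in arc_measure. cmod ((t \<circ> \<phi>) z) \<le> C"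
        using C AE_space by eventually_elim (simp add: t\<phi>)
      moreover have "t \<circ> \<phi> \<in> borel_measurable arc_measure" by measurable
      ultimately show "t \<circ> \<phi> \<in> L_infty" by (intro L_inftyI)
      show "AE z in arc_measure. s z = (t \<circ> \<phi>) z" by (intro AE_I2) (simp add: t\<phi>)
    qed
    ultimately show "ennreal (\<alpha> s) \<le> ext_norm \<alpha> (\<lambda>z. g z * indicator E' z)"
      by (simp add: inv[OF t])
  qed
  with E' meas show ?thesis by blast
qed

text \<open>The target is closed and convex, so only the generators of the hull matter. For these,
  the factor \<open>u\<close> only decreases the norm, and \<open>\<phi>\<close> moves the estimate
  from \<open>E\<close> to a set of the same measure.\<close>

lemma closure_dominated_hull_subset:
  assumes g: "g \<in> small_on_small_sets \<delta> c"
  shows "in_measure_topology closure_of dominated_hull \<alpha> g \<subseteq> small_on_small_sets \<delta> c"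
proof (rule closure_of_minimal)
  show "closedin in_measure_topology (small_on_small_sets \<delta> c)"
  proof (rule closedin_in_measure_topologyI)
    show "small_on_small_sets \<delta> c \<subseteq> borel_measurable arc_measure"
      using small_on_small_sets_measurable by blast
  qed (rule small_on_small_sets_limit)
  show "dominated_hull \<alpha> g \<subseteq> small_on_small_sets \<delta> c"
    unfolding dominated_hull_def
  proof (rule hull_minimal[where S = convex, OF _ convex_small_on_small_sets], clarify)
    fix u \<phi> assume u: "u \<in> L_infty" "esssup_norm u \<le> 1" and \<phi>: "\<phi> \<in> sym_group \<alpha>"
    have gm: "g \<in> borel_measurable arc_measure" using g by (rule small_on_small_sets_measurable)
    have [measurable]: "\<phi> \<in> measurable arc_measure arc_measure"
      using \<phi> by (simp add: sym_group_def)
    note [measurable] = gm L_infty_measurable[OF u(1)]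
    have "AE z in arc_measure. ereal (cmod (u z)) \<le> esssup_norm u"
      unfolding esssup_norm_def by (rule esssup_AE)
    then have u1: "AE z in arc_measure. cmod (u z) \<le> 1"
    proof eventually_elim
      case (elim z)
      then have "ereal (cmod (u z)) \<le> 1" using u(2) by (rule order_trans)
      then show ?case by simp
    qed
    show "(\<lambda>z. complex_of_real (cmod (g (\<phi> z))) * u z) \<in> small_on_small_sets \<delta> c"
      unfolding small_on_small_sets_def
    proof (intro CollectI conjI ballI impI)
      fix E assume E: "E \<in> sets arc_measure" and m: "measure arc_measure E < \<delta>"
      obtain E' where E': "E' \<in> sets arc_measure" "measure arc_measure E' = measure arc_measure E"
        and le: "ext_norm \<alpha> (\<lambda>z. g (\<phi> z) * indicator E z)
          \<le> ext_norm \<alpha> (\<lambda>z. g z * indicator E' z)"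
        using ext_norm_sym_le[OF gm \<phi> E] by blast
      have "ext_norm \<alpha> (\<lambda>z. complex_of_real (cmod (g (\<phi> z))) * u z * indicator E z)
          \<le> ext_norm \<alpha> (\<lambda>z. g (\<phi> z) * indicator E z)"
      proof (rule ext_norm_mono)
        show "AE z in arc_measure. cmod (complex_of_real (cmod (g (\<phi> z))) * u z * indicator E z)
            \<le> cmod (g (\<phi> z) * indicator E z)"
          using u1 by eventually_elim (simp add: norm_mult indicator_def mult_left_le)
      qed
      also note le
      also have "ext_norm \<alpha> (\<lambda>z. g z * indicator E' z) \<le> c"
        using g E' m by (intro small_on_small_setsD) auto
      finally show "ext_norm \<alpha> (\<lambda>z. complex_of_real (cmod (g (\<phi> z))) * u z * indicator E z) \<le> c" .
    qed measurable
  qed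
qed

section \<open>The equivalences\<close>

lemma script_L_measurable: "g \<in> script_L \<alpha> \<Longrightarrow> g \<in> borel_measurable arc_measure"
  by (simp add: script_L_def)

text \<open>Restates the limit as a membership. Null sets, which the filter ignores, are added by
  hand: there the product is a.e. zero.\<close>

lemma general_continuityD:
  assumes gc: "general_continuity \<alpha>" and g: "g \<in> script_L \<alpha>" and \<epsilon>: "0 < \<epsilon>"
  obtains \<delta> where "0 < \<delta>" "g \<in> small_on_small_sets \<delta> \<epsilon>"
proof -
  note [measurable] = script_L_measurable[OF g]
  have "((\<lambda>E. ext_norm \<alpha> (\<lambda>z. g z * indicator E z)) \<longlongrightarrow> 0) small_sets"
    using gc g by (simp add: general_continuity_def)
  then have "eventually (\<lambda>E. ext_norm \<alpha> (\<lambda>z. g z * indicator E z) < \<epsilon>) small_sets"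
    using \<epsilon> by (rule order_tendstoD)
  then obtain \<delta> where \<delta>: "0 < \<delta>" "\<And>E. E \<in> sets arc_measure \<Longrightarrow> 0 < measure arc_measure E \<Longrightarrow>
      measure arc_measure E < \<delta> \<Longrightarrow> ext_norm \<alpha> (\<lambda>z. g z * indicator E z) < \<epsilon>"
    unfolding eventually_small_sets by blast
  have "ext_norm \<alpha> (\<lambda>z. g z * indicator E z) \<le> \<epsilon>"
    if E: "E \<in> sets arc_measure" and m: "measure arc_measure E < \<delta>" for E
  proof (cases "measure arc_measure E = 0")
    case True
    then have null: "AE z in arc_measure. z \<notin> E"
      using E by (intro AE_not_in) (simp add: null_sets_def arc.emeasure_eq_measure)
    have "ext_norm \<alpha> (\<lambda>z. g z * indicator E z) \<le> ext_norm \<alpha> (\<lambda>_. 0)"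
    proof (rule ext_norm_mono)
      show "AE z in arc_measure. cmod (g z * indicator E z) \<le> cmod 0"
        using null by eventually_elim simp
    qed
    also have "\<dots> \<le> 0" using ext_norm_const_le[of 0] by simp
    finally show ?thesis using \<epsilon> by simp
  next
    case False
    then show ?thesis using \<delta>(2)[OF E] m by (simp add: zero_less_measure_iff)
  qed
  then have "g \<in> small_on_small_sets \<delta> \<epsilon>" by (simp add: small_on_small_sets_def)
  with \<delta>(1) show thesis by (rule that)
qed

section \<open>Truncations of a measurable function\<close>

lemma truncation_L_infty:
  assumes [measurable]: "g \<in> borel_measurable arc_measure"
  shows "(\<lambda>z. g z * indicator {z. cmod (g z) \<le> c} z) \<in> L_infty"
  by (rule L_inftyI[where C = "max 0 c"]) (auto simp: indicator_def)

text \<open>The tails decrease to the empty set because \<open>g\<close> is finite everywhere, and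
  the measure is finite.\<close>

lemma measure_tail_tendsto_0:
  assumes "g \<in> borel_measurable arc_measure"
  shows "(\<lambda>n. measure arc_measure {z \<in> unit_circle. real n < cmod (g z)}) \<longlonglongrightarrow> 0"
proof -
  note [measurable] = assms
  have sets: "{z \<in> unit_circle. real n < cmod (g z)} \<in> sets arc_measure" for n
  by (rule sets_arc_measure_Collect) measurable
  have "(\<lambda>n. measure arc_measure {z \<in> unit_circle. real n < cmod (g z)}) \<longlonglongrightarrow>
      measure arc_measure (\<Inter>n. {z \<in> unit_circle. real n < cmod (g z)})"
    using sets by (intro arc.finite_Lim_measure_decseq) (auto simp: decseq_def)
  moreover have "(\<Inter>n. {z \<in> unit_circle. real n < cmod (g z)}) = {}"
  proof -
    have "\<exists>n. \<not> real n < cmod (g z)" for z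
      using reals_Archimedean2[of "cmod (g z)"] by (auto intro: less_imp_le simp: not_less)
    then show ?thesis by auto
  qed
  ultimately show ?thesis by simp
qed

lemma L_alpha_subset: "L_alpha \<alpha> \<subseteq> script_L \<alpha>"
  by (auto simp: L_alpha_def)

text \<open>Puts the truncations of \<open>g\<close> into the dominated hull of \<open>g\<close>.
  Its \<open>inv_into\<close> agrees with the identity on the circle, which is all that
  measurability sees.\<close>

lemma id_sym_group: "(\<lambda>z. z) \<in> sym_group \<alpha>"
proof -
  have "inv_into unit_circle (\<lambda>z. z) \<in> measurable arc_measure arc_measure
      \<longleftrightarrow> (\<lambda>z. z) \<in> measurable arc_measure arc_measure"
    by (intro measurable_cong) (simp add: inv_into_f_f[of "\<lambda>z. z", simplified])
  moreover have "distr arc_measure arc_measure (\<lambda>z. z) = arc_measure"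
    by (rule distr_id)
  ultimately show ?thesis by (auto simp: sym_group_def comp_def bij_betw_def)
qed

lemma dominated_convergence_imp_strongly_continuous:
  assumes dc: "dominated_convergence \<alpha>"
  shows "strongly_continuous \<alpha>"
  unfolding strongly_continuous_def
proof (intro antisym L_alpha_subset subsetI)
  fix g assume g: "g \<in> script_L \<alpha>"
  note [measurable] = script_L_measurable[OF g]
  define F where "F n z = g z * indicator {z. cmod (g z) \<le> real n} z" for n :: nat and z
  have FL: "F n \<in> L_infty" for n unfolding F_def by (intro truncation_L_infty) measurable
  note [measurable] = L_infty_measurable[OF FL]
  have closure: "(\<lambda>z. complex_of_real (cmod (F n z)))
      \<in> in_measure_topology closure_of dominated_hull \<alpha> g" for n
  proof -
    \<comment> \<open>The modulus of the truncation is \<open>|g|\<close> times this indicator, a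
      generator of the hull with the identity as symmetry.\<close>
    let ?u = "indicator {z. cmod (g z) \<le> real n} :: complex \<Rightarrow> complex"
    have um: "?u \<in> borel_measurable arc_measure" by measurable
    have u1: "AE z in arc_measure. cmod (?u z) \<le> 1" by (auto simp: indicator_def)
    have "(\<lambda>z. complex_of_real (cmod (F n z)))
        = (\<lambda>z. complex_of_real (cmod (g ((\<lambda>z. z) z))) * ?u z)"
      by (auto simp: F_def norm_mult indicator_def)
    moreover have "(\<lambda>z. complex_of_real (cmod (g ((\<lambda>z. z) z))) * ?u z) \<in> dominated_hull \<alpha> g"
      unfolding dominated_hull_def
    proof (rule hull_inc, intro CollectI exI conjI)
      show "esssup_norm ?u \<le> 1" using esssup_norm_le[OF um u1] by (simp add: one_ereal_def)
    qed (use L_inftyI[OF um u1] id_sym_group in auto)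
    ultimately show ?thesis
      by (auto simp: in_closure_of topspace_in_measure_topology)
  qed
  have "converges_in_measure F g"
    unfolding converges_in_measure_def
  proof (intro allI impI)
    fix \<epsilon> :: real assume "0 < \<epsilon>"
    have sets: "{z \<in> unit_circle. real n < cmod (g z)} \<in> sets arc_measure" for n
    by (rule sets_arc_measure_Collect) measurable
    \<comment> \<open>The truncation differs from \<open>g\<close> only where \<open>|g|\<close>
      exceeds \<open>n\<close>, whatever the value of \<epsilon>.\<close>
    have "measure arc_measure {z \<in> unit_circle. \<epsilon> \<le> cmod (F n z - g z)}
        \<le> measure arc_measure {z \<in> unit_circle. real n < cmod (g z)}" for n
      using \<open>0 < \<epsilon>\<close> by (intro arc.finite_measure_mono sets)
        (auto simp: F_def indicator_def split: if_splits)
    then show "(\<lambda>n. measure arc_measure {z \<in> unit_circle. \<epsilon> \<le> cmod (F n z - g z)}) \<longlonglongrightarrow> 0"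
      by (rule measure_tendsto_0_mono)
        (rule measure_tail_tendsto_0[OF script_L_measurable[OF g]])
  qed
  then have lim: "(\<lambda>n. ext_norm \<alpha> (\<lambda>z. F n z - g z)) \<longlonglongrightarrow> 0"
    using dc g closure L_infty_measurable[OF FL] script_L_measurable[OF g]
    unfolding dominated_convergence_def by blast
  show "g \<in> L_alpha \<alpha>"
    unfolding L_alpha_def
  proof (intro CollectI conjI allI impI g)
    fix \<epsilon> :: ennreal assume "0 < \<epsilon>"
    with lim have "eventually (\<lambda>n. ext_norm \<alpha> (\<lambda>z. F n z - g z) < \<epsilon>) sequentially"
      by (intro order_tendstoD)
    then obtain n where n: "ext_norm \<alpha> (\<lambda>z. F n z - g z) < \<epsilon>"
      by (auto simp: eventually_sequentially)
    have "ext_norm \<alpha> (\<lambda>z. g z - F n z) \<le> ext_norm \<alpha> (\<lambda>z. F n z - g z)"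
      by (intro ext_norm_mono AE_I2) (simp add: norm_minus_commute)
    with n FL[of n] show "\<exists>h\<in>L_infty. ext_norm \<alpha> (\<lambda>z. g z - h z) < \<epsilon>"
      by (auto intro: le_less_trans)
  qed
qed

text \<open>On \<open>E\<close>, the function \<open>g\<close> is at most \<open>|g - h|\<close>
  plus \<open>|h|\<close> for a bounded approximant \<open>h\<close>. The first part is small
  uniformly in \<open>E\<close>, and the second is dominated by a constant times the indicator of
  \<open>E\<close>.\<close>

lemma strongly_continuous_imp_general_continuity:
  assumes sc: "strongly_continuous \<alpha>"
  shows "general_continuity \<alpha>"
  unfolding general_continuity_def
proof (intro ballI order_tendstoI)
  fix g and \<epsilon> :: ennreal assume g: "g \<in> script_L \<alpha>" and \<epsilon>: "0 < \<epsilon>"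
  note [measurable] = script_L_measurable[OF g]
  obtain e :: real where e: "0 < e" "ennreal e < \<epsilon>"
    using \<epsilon> by (rule ennreal_positive_below)
  have "g \<in> L_alpha \<alpha>" using g sc by (simp add: strongly_continuous_def)
  moreover have "0 < ennreal (e / 2)" using e by simp
  ultimately obtain h where h: "h \<in> L_infty" and gh: "ext_norm \<alpha> (\<lambda>z. g z - h z) < ennreal (e / 2)"
    unfolding L_alpha_def by blast
  note [measurable] = L_infty_measurable[OF h]
  obtain C where C: "0 \<le> C" "AE z in arc_measure. cmod (h z) \<le> C"
    using L_infty_AE_bound[OF h] by blast
  \<comment> \<open>Chosen so that \<open>C\<close> times the norm of the indicator stays below
    \<open>e / 2\<close>, also when \<open>C = 0\<close>.\<close>
  have "0 < e / (2 * (C + 1))" using e C(1) by simp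
  then obtain \<delta> where \<delta>: "0 < \<delta>" "\<And>E. E \<in> sets arc_measure \<Longrightarrow> measure arc_measure E < \<delta> \<Longrightarrow>
      \<alpha> (indicator E) < e / (2 * (C + 1))"
    using norm_indicator_continuous by metis
  have "ext_norm \<alpha> (\<lambda>z. g z * indicator E z) < \<epsilon>"
    if E [measurable]: "E \<in> sets arc_measure" and m: "measure arc_measure E < \<delta>" for E
  proof -
    have ind: "(indicator E :: complex \<Rightarrow> complex) \<in> L_infty"
      by (intro L_inftyI[where C = 1]) (auto simp: indicator_def)
    have "ext_norm \<alpha> (\<lambda>z. h z * indicator E z)
        \<le> ext_norm \<alpha> (\<lambda>z. complex_of_real C * indicator E z)"
    proof (rule ext_norm_mono)
      show "AE z in arc_measure. cmod (h z * indicator E z) \<le> cmod (complex_of_real C * indicator E z)"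
        using C(2) by eventually_elim (use C(1) in \<open>simp add: norm_mult indicator_def\<close>)
    qed
    also have "\<dots> \<le> ennreal C * ext_norm \<alpha> (indicator E)"
      using ext_norm_mult_le[of "complex_of_real C" "indicator E"] C(1) by simp
    also have "\<dots> \<le> ennreal C * ennreal (\<alpha> (indicator E))"
      by (intro mult_left_mono ext_norm_le_norm ind) simp
    also have "\<dots> = ennreal (C * \<alpha> (indicator E))"
      using C(1) nonneg[OF ind] by (simp add: ennreal_mult)
    also have "\<dots> \<le> ennreal (e / 2)"
    proof (rule ennreal_leI)
      have "C * \<alpha> (indicator E) \<le> (C + 1) * (e / (2 * (C + 1)))"
        using \<delta>(2)[OF E m] C(1) nonneg[OF ind] by (intro mult_mono) auto
      also have "\<dots> = e / 2" using C(1) by (simp add: field_simps)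
      finally show "C * \<alpha> (indicator E) \<le> e / 2" .
    qed
    finally have hE: "ext_norm \<alpha> (\<lambda>z. h z * indicator E z) \<le> ennreal (e / 2)" .
    have "ext_norm \<alpha> (\<lambda>z. g z * indicator E z)
        \<le> ext_norm \<alpha> (\<lambda>z. g z - h z) + ext_norm \<alpha> (\<lambda>z. h z * indicator E z)"
    proof (rule ext_norm_dominated_sum)
      show "cmod (g z * indicator E z) \<le> cmod (g z - h z) + cmod (h z * indicator E z)" for z
        using norm_triangle_ineq[of "g z - h z" "h z"] by (auto simp: indicator_def)
    qed measurable
    also have "\<dots> \<le> ennreal (e / 2) + ennreal (e / 2)"
      using gh hE by (intro add_mono) auto
    also have "\<dots> = ennreal e" using e by (simp flip: ennreal_plus)
    also have "\<dots> < \<epsilon>" by (rule e)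
    finally show ?thesis .
  qed
  with \<delta>(1) show "eventually (\<lambda>E. ext_norm \<alpha> (\<lambda>z. g z * indicator E z) < \<epsilon>) small_sets"
    unfolding eventually_small_sets by blast
qed simp

lemma general_continuity_imp_dominated_convergence:
  assumes gc: "general_continuity \<alpha>"
  shows "dominated_convergence \<alpha>"
  unfolding dominated_convergence_def
proof (intro ballI allI impI)
  fix g F f
  assume g: "g \<in> script_L \<alpha>" and "\<forall>n. F n \<in> borel_measurable arc_measure"
    and f: "f \<in> borel_measurable arc_measure"
    and closure: "\<forall>n. (\<lambda>z. complex_of_real (cmod (F n z)))
      \<in> in_measure_topology closure_of dominated_hull \<alpha> g"
    and lim: "converges_in_measure F f"
  then have F: "F n \<in> borel_measurable arc_measure" for n by blast
  note [measurable] = F f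
  \<comment> \<open>A pair \<open>\<delta>\<close>, \<open>c\<close> that works for \<open>g\<close>
    works for every \<open>F n\<close> simultaneously; this is the uniformity that makes the
    convergence argument possible.\<close>
  have F_small: "F n \<in> small_on_small_sets \<delta> c" if "g \<in> small_on_small_sets \<delta> c" for n \<delta> c
    using closure closure_dominated_hull_subset[OF that] small_on_small_sets_abs_iff[OF F] by blast
  have f_small: "f \<in> small_on_small_sets \<delta> c" if "g \<in> small_on_small_sets \<delta> c" for \<delta> c
    using F_small[OF that] f lim by (rule small_on_small_sets_limit)
  \<comment> \<open>The value 2 is any number above the total mass 1, for which membership is the
    same as a bound on the extended norm.\<close>
  have "ext_norm \<alpha> f \<le> ext_norm \<alpha> g"
    using f_small[of 2 "ext_norm \<alpha> g"] script_L_measurable[OF g] f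
    by (simp add: ext_norm_le_iff_small_on_small_sets)
  then have "f \<in> script_L \<alpha>"
    using g f by (auto simp: script_L_def)
  moreover have "(\<lambda>n. ext_norm \<alpha> (\<lambda>z. F n z - f z)) \<longlonglongrightarrow> 0"
  proof (rule order_tendstoI)
    fix \<epsilon> :: ennreal assume \<epsilon>: "0 < \<epsilon>"
    obtain e :: real where e: "0 < e" "ennreal e < \<epsilon>"
    using \<epsilon> by (rule ennreal_positive_below)
    \<comment> \<open>One third each for the set where \<open>|F n - f|\<close> is below
      \<open>e / 3\<close>, for \<open>F n\<close> on the exceptional set, and for \<open>f\<close>
      on it.\<close>
    have "0 < ennreal (e / 3)" using e by simp
    then obtain \<delta> where \<delta>: "0 < \<delta>" and g_small: "g \<in> small_on_small_sets \<delta> (ennreal (e / 3))"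
      using general_continuityD[OF gc g] by blast
    have "(\<lambda>n. measure arc_measure {z \<in> unit_circle. e / 3 \<le> cmod (F n z - f z)}) \<longlonglongrightarrow> 0"
    proof -
      have "0 < e / 3" using e by simp
      then show ?thesis using lim unfolding converges_in_measure_def by blast
    qed
    from order_tendstoD(2)[OF this \<delta>]
    show "\<forall>\<^sub>F n in sequentially. ext_norm \<alpha> (\<lambda>z. F n z - f z) < \<epsilon>"
    proof eventually_elim
      case (elim n)
      define E where "E = {z \<in> unit_circle. e / 3 \<le> cmod (F n z - f z)}"
      have "{z \<in> space arc_measure. e / 3 \<le> cmod (F n z - f z)} \<in> sets arc_measure" by measurable
      then have E [measurable]: "E \<in> sets arc_measure" by (simp add: E_def)
      have m: "measure arc_measure E < \<delta>" using elim by (simp add: E_def)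
      have "ext_norm \<alpha> (\<lambda>z. F n z - f z)
          \<le> ext_norm \<alpha> (\<lambda>_. complex_of_real (e / 3))
            + ext_norm \<alpha> (\<lambda>z. F n z * indicator E z - f z * indicator E z)"
      proof (rule ext_norm_dominated_sum)
        show "cmod (F n z - f z) \<le> cmod (complex_of_real (e / 3))
            + cmod (F n z * indicator E z - f z * indicator E z)" if "z \<in> unit_circle" for z
          using that e unfolding norm_of_real by (auto simp: E_def indicator_def)
      qed measurable
      also have "ext_norm \<alpha> (\<lambda>z. F n z * indicator E z - f z * indicator E z)
          \<le> ext_norm \<alpha> (\<lambda>z. F n z * indicator E z) + ext_norm \<alpha> (\<lambda>z. f z * indicator E z)"
        by (rule ext_norm_dominated_sum) (auto intro: norm_triangle_ineq4)
      also have "ext_norm \<alpha> (\<lambda>_. complex_of_real (e / 3)) \<le> ennreal (e / 3)"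
        using ext_norm_const_le[of "complex_of_real (e / 3)"] e by simp
      also have "ext_norm \<alpha> (\<lambda>z. F n z * indicator E z) \<le> ennreal (e / 3)"
        using F_small[OF g_small] E m by (rule small_on_small_setsD)
      also have "ext_norm \<alpha> (\<lambda>z. f z * indicator E z) \<le> ennreal (e / 3)"
        using f_small[OF g_small] E m by (rule small_on_small_setsD)
      also have "ennreal (e / 3) + (ennreal (e / 3) + ennreal (e / 3)) = ennreal e"
        using e by (simp flip: ennreal_plus)
      also note e(2)
      finally show ?case by (simp add: add_mono)
    qed
  qed simp
  ultimately show "f \<in> script_L \<alpha> \<and> (\<lambda>n. ext_norm \<alpha> (\<lambda>z. F n z - f z)) \<longlonglongrightarrow> 0" ..
qed

end

theorem proposition4p7:
  fixes \<alpha> :: "(complex \<Rightarrow> complex) \<Rightarrow> real"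
  assumes "cont_rot_sym_norm \<alpha>"
  shows "(general_continuity \<alpha> \<longleftrightarrow> dominated_convergence \<alpha>) \<and>
         (dominated_convergence \<alpha> \<longleftrightarrow> strongly_continuous \<alpha>)"
proof -
  interpret cont_rot_sym_norm \<alpha> by (rule assms)
  show ?thesis
    using general_continuity_imp_dominated_convergence dominated_convergence_imp_strongly_continuous
      strongly_continuous_imp_general_continuity by blast
qed

end
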